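(* Let $(X,\mu)$ be a generalized topological space. (a) The following are equivalent: $(X,\mu)$ is $T_{3.5}$; $(X,\mu)$ is homeomorphic to a subspace of a $T_4$ GTS; $(X,\mu)$ is homeomorphic to a dense subspace of a $T_4$ GTS. Moreover, in the last two conditions the $T_4$ GTS can be supposed to be also compact. (b) The following are equivalent: $(X,\mu)$ is completely regular; $\mu$ is the weak structure on $X$ with respect to some map from the set $X$ to (the underlying set of) a $T_4$ GTS; $\mu$ is the weak structure on $X$ with respect to some dense map from the set $X$ to (the underlying set of) a $T_4$ GTS. Moreover, in the last two conditions the $T_4$ GTS can be supposed to be also compact.
   Context: A generalized topology (GT) on a set $X$ (possibly empty) is a family $\mu\subset P(X)$ with $\emptyset\in\mu$ closed under arbitrary unions; $(X,\mu)$ is a generalized topological space (GTS); members of $\mu$ are open, their complements closed. A map $f:(X,\mu)\to(Y,\nu)$ is continuous if $f^{-1}(N)\in\mu$ for all $N\in\nu$; a homeomorphism is a continuous bijection with continuous inverse. The closure of $A$ is the intersection of all closed sets containing $A$; $A\subset Y$ is dense in $(Y,\nu)$ if its closure is $Y$, and a map into $(Y,\nu)$ is dense if its image is dense. The subspace on $X_0\subset X$ has GT $\{M\cap X_0\mid M\in\mu\}$. For a function $\varphi:X\to Y$ into a GTS $(Y,\nu)$, the weak structure on $X$ with respect to $\varphi$ is $\{\varphi^{-1}(N)\mid N\in\nu\}$. $\gamma_0$ is the GT on $[0,1]$ consisting of all unions of (possibly empty) subfamilies of $\{[0,1]\cap(-\infty,s)\mid s\in\mathbb{R}\}\cup\{[0,1]\cap(t,\infty)\mid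 t\in\mathbb{R}\}$. A GTS $(X,\mu)$ is completely regular if for each $x\in X$ and each closed $F$ with $x\notin F$ there is a continuous $f:(X,\mu)\to([0,1],\gamma_0)$ with $f(x)=0$ and $f(F)\subset\{1\}$. It is $T_1$ if for any distinct points $x,y$ there is an open set containing $x$ but not $y$; $T_{3.5}$ if completely regular and $T_1$; normal if any two disjoint closed sets are contained in disjoint open sets, respectively; $T_4$ if normal and $T_1$; compact if every cover of $X$ by open sets has a finite subcover (so vacuously compact if $X\notin\mu$). *)

theory Defs
  imports Complex_Main "HOL-Library.FuncSet"
begin

text \<open>
  A generalized topological space is a pair of a carrier \<open>X\<close> and a family \<open>\<mu>\<close> of subsets of it.
  The carrier has to be recorded separately, because \<open>\<Union>\<mu>\<close> may be a proper subset of \<open>X\<close>.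
\<close>

definition gts :: "'a set \<Rightarrow> 'a set set \<Rightarrow> bool" where
  "gts X \<mu> \<longleftrightarrow> \<mu> \<subseteq> Pow X \<and> {} \<in> \<mu> \<and> (\<forall>\<S>. \<S> \<subseteq> \<mu> \<longrightarrow> \<Union>\<S> \<in> \<mu>)"

definition gt_closed :: "'a set \<Rightarrow> 'a set set \<Rightarrow> 'a set \<Rightarrow> bool" where
  "gt_closed X \<mu> F \<longleftrightarrow> F \<subseteq> X \<and> X - F \<in> \<mu>"

definition gt_closure :: "'a set \<Rightarrow> 'a set set \<Rightarrow> 'a set \<Rightarrow> 'a set" where
  "gt_closure X \<mu> A = \<Inter>{F. gt_closed X \<mu> F \<and> A \<subseteq> F}"

definition gt_dense :: "'a set \<Rightarrow> 'a set set \<Rightarrow> 'a set \<Rightarrow> bool" where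
  "gt_dense X \<mu> A \<longleftrightarrow> A \<subseteq> X \<and> gt_closure X \<mu> A = X"

definition gt_subspace :: "'a set set \<Rightarrow> 'a set \<Rightarrow> 'a set set" where
  "gt_subspace \<mu> S = {M \<inter> S | M. M \<in> \<mu>}"

definition weak_structure :: "'a set \<Rightarrow> 'b set set \<Rightarrow> ('a \<Rightarrow> 'b) \<Rightarrow> 'a set set" where
  "weak_structure X \<nu> \<phi> = {\<phi> -` N \<inter> X | N. N \<in> \<nu>}"

definition gt_continuous ::
  "'a set \<Rightarrow> 'a set set \<Rightarrow> 'b set \<Rightarrow> 'b set set \<Rightarrow> ('a \<Rightarrow> 'b) \<Rightarrow> bool" where
  "gt_continuous X \<mu> Y \<nu> f \<longleftrightarrow> f \<in> X \<rightarrow> Y \<and> (\<forall>N\<in>\<nu>. f -` N \<inter> X \<in> \<mu>)"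

definition gt_homeomorphism ::
  "'a set \<Rightarrow> 'a set set \<Rightarrow> 'b set \<Rightarrow> 'b set set \<Rightarrow> ('a \<Rightarrow> 'b) \<Rightarrow> bool" where
  "gt_homeomorphism X \<mu> Y \<nu> f \<longleftrightarrow>
     bij_betw f X Y \<and> gt_continuous X \<mu> Y \<nu> f \<and> gt_continuous Y \<nu> X \<mu> (inv_into X f)"

definition gt_homeomorphic ::
  "'a set \<Rightarrow> 'a set set \<Rightarrow> 'b set \<Rightarrow> 'b set set \<Rightarrow> bool" where
  "gt_homeomorphic X \<mu> Y \<nu> \<longleftrightarrow> (\<exists>f. gt_homeomorphism X \<mu> Y \<nu> f)"

definition gamma0 :: "real set set" where
  "gamma0 = {\<Union>\<S> | \<S>. \<S> \<subseteq> {{0..1} \<inter> {..<s} | s. True} \<union> {{0..1} \<inter> {t<..} | t. True}}"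

definition gt_completely_regular :: "'a set \<Rightarrow> 'a set set \<Rightarrow> bool" where
  "gt_completely_regular X \<mu> \<longleftrightarrow>
     (\<forall>x\<in>X. \<forall>F. gt_closed X \<mu> F \<and> x \<notin> F \<longrightarrow>
        (\<exists>f. gt_continuous X \<mu> {0..1} gamma0 f \<and> f x = 0 \<and> f ` F \<subseteq> {1}))"

definition gt_T1 :: "'a set \<Rightarrow> 'a set set \<Rightarrow> bool" where
  "gt_T1 X \<mu> \<longleftrightarrow> (\<forall>x\<in>X. \<forall>y\<in>X. x \<noteq> y \<longrightarrow> (\<exists>U\<in>\<mu>. x \<in> U \<and> y \<notin> U))"

definition gt_T35 :: "'a set \<Rightarrow> 'a set set \<Rightarrow> bool" where
  "gt_T35 X \<mu> \<longleftrightarrow> gt_completely_regular X \<mu> \<and> gt_T1 X \<mu>"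

definition gt_normal :: "'a set \<Rightarrow> 'a set set \<Rightarrow> bool" where
  "gt_normal X \<mu> \<longleftrightarrow>
     (\<forall>F G. gt_closed X \<mu> F \<and> gt_closed X \<mu> G \<and> F \<inter> G = {} \<longrightarrow>
        (\<exists>U\<in>\<mu>. \<exists>V\<in>\<mu>. F \<subseteq> U \<and> G \<subseteq> V \<and> U \<inter> V = {}))"

definition gt_T4 :: "'a set \<Rightarrow> 'a set set \<Rightarrow> bool" where
  "gt_T4 X \<mu> \<longleftrightarrow> gt_normal X \<mu> \<and> gt_T1 X \<mu>"

definition gt_compact :: "'a set \<Rightarrow> 'a set set \<Rightarrow> bool" where
  "gt_compact X \<mu> \<longleftrightarrow>
     (\<forall>\<U>. \<U> \<subseteq> \<mu> \<and> \<Union>\<U> = X \<longrightarrow> (\<exists>\<V>. \<V> \<subseteq> \<U> \<and> finite \<V> \<and> \<Union>\<V> = X))"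

definition gt_compact_T4 :: "'a set \<Rightarrow> 'a set set \<Rightarrow> bool" where
  "gt_compact_T4 X \<mu> \<longleftrightarrow> gt_compact X \<mu> \<and> gt_T4 X \<mu>"

text \<open>
  In the following predicates \<open>P\<close> is the property required of the target space. The argument \<open>B\<close> only
  makes visible the type in which the carrier \<open>Y\<close> of the target space is sought.
\<close>

definition homeomorphic_to_subspace_of ::
  "'b itself \<Rightarrow> ('b set \<Rightarrow> 'b set set \<Rightarrow> bool) \<Rightarrow>
   'a set \<Rightarrow> 'a set set \<Rightarrow> bool" where
  "homeomorphic_to_subspace_of B P X \<mu> \<longleftrightarrow>
     (\<exists>Y \<nu> S. gts Y \<nu> \<and> P Y \<nu> \<and> S \<subseteq> Y \<and> gt_homeomorphic X \<mu> S (gt_subspace \<nu> S))"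

definition homeomorphic_to_dense_subspace_of ::
  "'b itself \<Rightarrow> ('b set \<Rightarrow> 'b set set \<Rightarrow> bool) \<Rightarrow>
   'a set \<Rightarrow> 'a set set \<Rightarrow> bool" where
  "homeomorphic_to_dense_subspace_of B P X \<mu> \<longleftrightarrow>
     (\<exists>Y \<nu> S. gts Y \<nu> \<and> P Y \<nu> \<and> S \<subseteq> Y \<and> gt_dense Y \<nu> S \<and>
        gt_homeomorphic X \<mu> S (gt_subspace \<nu> S))"

definition weak_structure_of_map_to ::
  "'b itself \<Rightarrow> ('b set \<Rightarrow> 'b set set \<Rightarrow> bool) \<Rightarrow>
   'a set \<Rightarrow> 'a set set \<Rightarrow> bool" where
  "weak_structure_of_map_to B P X \<mu> \<longleftrightarrow>
     (\<exists>Y \<nu> \<phi>. gts Y \<nu> \<and> P Y \<nu> \<and> \<phi> \<in> X \<rightarrow> Y \<and> \<mu> = weak_structure X \<nu> \<phi>)"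

definition weak_structure_of_dense_map_to ::
  "'b itself \<Rightarrow> ('b set \<Rightarrow> 'b set set \<Rightarrow> bool) \<Rightarrow>
   'a set \<Rightarrow> 'a set set \<Rightarrow> bool" where
  "weak_structure_of_dense_map_to B P X \<mu> \<longleftrightarrow>
     (\<exists>Y \<nu> \<phi>. gts Y \<nu> \<and> P Y \<nu> \<and> \<phi> \<in> X \<rightarrow> Y \<and> gt_dense Y \<nu> (\<phi> ` X) \<and>
        \<mu> = weak_structure X \<nu> \<phi>)"

text \<open>
  A type large enough to contain, for every generalized topology on a set of type \<open>'a set\<close>, the
  power of \<open>[0,1]\<close> indexed by the continuous maps to \<open>[0,1]\<close>. HOL cannot quantify existentially
  over types, so the spaces whose existence is asserted are sought in this type; a space given as a
  hypothesis may have its carrier in an arbitrary type.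
\<close>

type_synonym 'a cube = "('a \<Rightarrow> real) \<Rightarrow> real"

end

theory Submission
  imports Defs "HOL-Analysis.Arcwise_Connected"
begin

text \<open>
  Urysohn's lemma and the embedding into a cube carry over to generalized topologies, and the
  second of them becomes easier than in the classical case.

  A \<open>T\<^sub>4\<close> space is completely regular: the construction in Urysohn's lemma (\<open>gt_Urysohn\<close>) produces
  preimages of rays as unions of open sets, and the topology \<open>gamma0\<close> asks for nothing else. A weak
  structure with respect to a map into a completely regular space is again completely regular
  (\<open>weak_structure_completely_regular\<close>), and it is \<open>T\<^sub>1\<close> if the space is and the map is injective. An
  embedding is an injective map with respect to which \<open>\<mu>\<close> is the weak structure
  (\<open>gt_homeomorphism_onto_subspace_iff\<close>), so these facts settle the sufficiency of all conditions.

  For the converse, give the cube \<open>[0,1]\<^sup>I\<close> the topology of all unions of coordinate rays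
  \<open>{p. p i < s}\<close> and \<open>{p. t < p i}\<close>. Because finite intersections are not taken, the nonempty closed
  sets are just boxes, and a family of boxes has empty intersection only if two of them are
  disjoint in some coordinate (\<open>cube_ray_cover\<close>, in terms of covers by rays). This makes the cube
  compact and \<open>T\<^sub>4\<close> at once. If \<open>I\<close> consists of the continuous functions on a completely regular
  space, the space has the weak structure with respect to the evaluation map
  (\<open>evaluation_weak_structure\<close>). Passing to the closure of the image makes this map dense, and under
  \<open>T\<^sub>1\<close> it is injective and so an embedding.

  The carrier \<open>X\<close> may fail to be open. Then there are no continuous functions into \<open>[0,1]\<close> at all, a
  completely regular \<open>X\<close> has only the empty open set, and the construction degenerates correctly:
  the cube is a single point, with the empty set as its only open set.
\<close>

section \<open>Open and closed sets\<close>

lemma gts_Union: "gts X \<mu> \<Longrightarrow> \<S> \<subseteq> \<mu> \<Longrightarrow> \<Union>\<S> \<in> \<mu>"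
  and gts_empty: "gts X \<mu> \<Longrightarrow> {} \<in> \<mu>"
  and gts_subset: "gts X \<mu> \<Longrightarrow> M \<in> \<mu> \<Longrightarrow> M \<subseteq> X"
  by (auto simp: gts_def)

lemma gts_Un: "gts X \<mu> \<Longrightarrow> M \<in> \<mu> \<Longrightarrow> N \<in> \<mu> \<Longrightarrow> M \<union> N \<in> \<mu>"
  using gts_Union[of X \<mu> "{M, N}"] by simp

text \<open>
  Intersections of open sets need not be open, but closure under arbitrary unions still lets
  openness be tested pointwise.
\<close>

lemma gts_openI:
  assumes "gts X \<mu>" and "\<And>x. x \<in> A \<Longrightarrow> \<exists>W\<in>\<mu>. x \<in> W \<and> W \<subseteq> A"
  shows "A \<in> \<mu>"
proof -
  have "A = \<Union>{W \<in> \<mu>. W \<subseteq> A}"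
    using assms(2) by blast
  also have "\<dots> \<in> \<mu>"
    by (rule gts_Union[OF assms(1)]) blast
  finally show ?thesis .
qed

lemma gt_closed_Diff: "gts X \<mu> \<Longrightarrow> M \<in> \<mu> \<Longrightarrow> gt_closed X \<mu> (X - M)"
  by (auto simp: gt_closed_def double_diff dest: gts_subset)

lemma gt_closed_Inter:
  assumes "gts X \<mu>" "\<F> \<noteq> {}" "\<And>F. F \<in> \<F> \<Longrightarrow> gt_closed X \<mu> F"
  shows "gt_closed X \<mu> (\<Inter>\<F>)"
proof -
  have "X - \<Inter>\<F> = \<Union>((\<lambda>F. X - F) ` \<F>)"
    by auto
  moreover have "\<dots> \<in> \<mu>"
    by (rule gts_Union[OF assms(1)]) (use assms(3) in \<open>auto simp: gt_closed_def\<close>)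
  ultimately show ?thesis
    using assms(2,3) by (auto simp: gt_closed_def)
qed

lemma gt_closed_closure:
  assumes "gts X \<mu>" "A \<subseteq> X"
  shows "gt_closed X \<mu> (gt_closure X \<mu> A)"
  unfolding gt_closure_def
proof (rule gt_closed_Inter[OF assms(1)])
  have "gt_closed X \<mu> X"
    using gts_empty[OF assms(1)] by (simp add: gt_closed_def)
  then show "{F. gt_closed X \<mu> F \<and> A \<subseteq> F} \<noteq> {}"
    using assms(2) by blast
qed simp

lemma subset_gt_closure: "A \<subseteq> gt_closure X \<mu> A"
  by (auto simp: gt_closure_def)

lemma gt_normalD:
  assumes "gt_normal X \<mu>" "gt_closed X \<mu> F" "gt_closed X \<mu> G" "F \<inter> G = {}"
  obtains U V where "U \<in> \<mu>" "V \<in> \<mu>" "F \<subseteq> U" "G \<subseteq> V" "U \<inter> V = {}"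
proof -
  have "\<exists>U\<in>\<mu>. \<exists>V\<in>\<mu>. F \<subseteq> U \<and> G \<subseteq> V \<and> U \<inter> V = {}"
    using assms by (simp add: gt_normal_def)
  then show thesis using that by blast
qed

text \<open>
  The generalized topology generated by \<open>\<B>\<close>: since no intersections have to be added, \<open>\<B>\<close> is at
  once a subbase and a base. The topology \<open>gamma0\<close> and that of a cube are both of this form.
\<close>

definition unions :: "'a set set \<Rightarrow> 'a set set" where
  "unions \<B> = {\<Union>\<S> |\<S>. \<S> \<subseteq> \<B>}"

lemma gts_unions:
  assumes "\<B> \<subseteq> Pow X"
  shows "gts X (unions \<B>)"
  unfolding gts_def
proof (intro conjI allI impI)
  show "unions \<B> \<subseteq> Pow X"
    using assms by (auto simp: unions_def)
  show "{} \<in> unions \<B>"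
    by (auto simp: unions_def)
  fix \<S> assume \<S>: "\<S> \<subseteq> unions \<B>"
  have "\<Union>\<S> = \<Union>{B \<in> \<B>. B \<subseteq> \<Union>\<S>}"
  proof
    show "\<Union>\<S> \<subseteq> \<Union>{B \<in> \<B>. B \<subseteq> \<Union>\<S>}"
    proof
      fix x assume "x \<in> \<Union>\<S>"
      then obtain M where "M \<in> \<S>" "x \<in> M" by blast
      moreover from this \<S> obtain \<T> where "\<T> \<subseteq> \<B>" "M = \<Union>\<T>"
        by (auto simp: unions_def)
      ultimately show "x \<in> \<Union>{B \<in> \<B>. B \<subseteq> \<Union>\<S>}" by blast
    qed
  qed blast
  then show "\<Union>\<S> \<in> unions \<B>"
    by (auto simp: unions_def)
qed

lemma unions_base: "B \<in> \<B> \<Longrightarrow> B \<in> unions \<B>"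
  unfolding unions_def by (rule CollectI, rule exI[of _ "{B}"]) auto

lemma gt_continuous_unions_iff:
  assumes "gts X \<mu>"
  shows "gt_continuous X \<mu> Y (unions \<B>) f \<longleftrightarrow> f \<in> X \<rightarrow> Y \<and> (\<forall>B\<in>\<B>. f -` B \<inter> X \<in> \<mu>)"
proof -
  have "f -` N \<inter> X \<in> \<mu>" if B: "\<forall>B\<in>\<B>. f -` B \<inter> X \<in> \<mu>" and "N \<in> unions \<B>" for N
  proof -
    from that(2) obtain \<S> where \<S>: "\<S> \<subseteq> \<B>" "N = \<Union>\<S>"
      by (auto simp: unions_def)
    have "f -` N \<inter> X = \<Union>((\<lambda>B. f -` B \<inter> X) ` \<S>)"
      using \<S> by auto
    also have "\<dots> \<in> \<mu>"
      by (rule gts_Union[OF assms]) (use B \<S> in blast)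
    finally show ?thesis .
  qed
  then show ?thesis
    by (auto simp: gt_continuous_def unions_base)
qed

text \<open>
  Only preimages of rays matter. Taking a ray that contains \<open>[0,1]\<close> shows that a continuous map to
  \<open>[0,1]\<close> exists only if the whole carrier is open.
\<close>

lemma gt_continuous_gamma0_iff:
  assumes "gts X \<mu>"
  shows "gt_continuous X \<mu> {0..1} gamma0 f \<longleftrightarrow>
    f \<in> X \<rightarrow> {0..1} \<and> (\<forall>s. {x \<in> X. f x < s} \<in> \<mu>) \<and> (\<forall>t. {x \<in> X. t < f x} \<in> \<mu>)"
proof -
  let ?B = "{{0..1} \<inter> {..<s} | s::real. True} \<union> {{0..1} \<inter> {t<..} | t::real. True}"
  have "gt_continuous X \<mu> {0..1} gamma0 f \<longleftrightarrow> f \<in> X \<rightarrow> {0..1} \<and> (\<forall>B\<in>?B. f -` B \<inter> X \<in> \<mu>)"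
    using gt_continuous_unions_iff[OF assms, of "{0..1}" ?B f] by (simp only: gamma0_def unions_def)
  also have "\<dots> \<longleftrightarrow> f \<in> X \<rightarrow> {0..1} \<and>
    (\<forall>s. f -` ({0..1} \<inter> {..<s}) \<inter> X \<in> \<mu>) \<and> (\<forall>t. f -` ({0..1} \<inter> {t<..}) \<inter> X \<in> \<mu>)"
    by blast
  also have "\<dots> \<longleftrightarrow> f \<in> X \<rightarrow> {0..1} \<and> (\<forall>s. {x \<in> X. f x < s} \<in> \<mu>) \<and> (\<forall>t. {x \<in> X. t < f x} \<in> \<mu>)"
  proof (rule conj_cong[OF refl])
    assume f: "f \<in> X \<rightarrow> {0..1}"
    have "f -` ({0..1} \<inter> {..<s}) \<inter> X = {x \<in> X. f x < s}"
      "f -` ({0..1} \<inter> {t<..}) \<inter> X = {x \<in> X. t < f x}" for s t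
      using f by (auto simp: Pi_iff)
    then show "((\<forall>s. f -` ({0..1} \<inter> {..<s}) \<inter> X \<in> \<mu>) \<and> (\<forall>t. f -` ({0..1} \<inter> {t<..}) \<inter> X \<in> \<mu>)) \<longleftrightarrow>
      ((\<forall>s. {x \<in> X. f x < s} \<in> \<mu>) \<and> (\<forall>t. {x \<in> X. t < f x} \<in> \<mu>))"
      by simp
  qed
  finally show ?thesis .
qed

section \<open>Normal spaces are completely regular\<close>

text \<open>
  In Urysohn's construction an open set is attached to each dyadic level, so there must be a level
  between any two values of the function.
\<close>

lemma dyadic_between:
  fixes a b :: real
  assumes "0 \<le> a" "a < b" "b \<le> 1"
  obtains r where "r \<in> dyadics \<inter> {0..1}" "a < r" "r < b"
proof -
  obtain n q r where qr: "real q / 2 ^ n < b" "b < real r / 2 ^ n"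
      "\<bar>q / 2 ^ n - r / 2 ^ n\<bar> < b - a"
    by (rule padic_rational_approximation_straddle_pos[of "b - a" 2 b]) (use assms in auto)
  have "real q / 2 ^ n \<in> dyadics"
    by (auto simp: dyadics_def)
  moreover have "a < real q / 2 ^ n"
    using qr by linarith
  ultimately show thesis
    using that[of "real q / 2 ^ n"] qr(1) assms by (simp del: divide_le_eq_1_pos)
qed

text \<open>
  The classical argument survives without finite intersections. Interpolating an open set and a
  closed set between a closed set and an open set around it uses normality alone; iterating this
  over the dyadic numbers gives nested open sets \<open>U r\<close>. For the function
  \<open>f x = inf {r. x \<in> U r}\<close>, the preimage of a lower ray is a union of sets \<open>U r\<close>, and that of an
  upper ray is a union of complements of closed sets interpolated between two levels.

  The preimages of the rays that contain \<open>[0,1]\<close> are \<open>X\<close> itself. It is open because it is the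
  union of the complements of the two given disjoint closed sets.
\<close>

lemma gt_Urysohn:
  assumes gts: "gts X \<mu>" and normal: "gt_normal X \<mu>"
    and F: "gt_closed X \<mu> F" and G: "gt_closed X \<mu> G" and disj: "F \<inter> G = {}"
  obtains f where "gt_continuous X \<mu> {0..1} gamma0 f" "f ` F \<subseteq> {0}" "f ` G \<subseteq> {1}"
proof -
  define R where "R U V \<longleftrightarrow> U \<in> \<mu> \<and> V \<in> \<mu> \<and> (\<exists>C. gt_closed X \<mu> C \<and> U \<subseteq> C \<and> C \<subseteq> V)" for U V
  have between: "\<exists>W. W \<in> \<mu> \<and> C \<subseteq> W \<and> (\<exists>D. gt_closed X \<mu> D \<and> W \<subseteq> D \<and> D \<subseteq> V)"
    if C: "gt_closed X \<mu> C" and V: "V \<in> \<mu>" "C \<subseteq> V" for C V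
  proof -
    have "gt_closed X \<mu> (X - V)" "C \<inter> (X - V) = {}"
      using V gt_closed_Diff[OF gts] by auto
    then obtain W W' where W: "W \<in> \<mu>" "W' \<in> \<mu>" "C \<subseteq> W" "X - V \<subseteq> W'" "W \<inter> W' = {}"
      using gt_normalD[OF normal C] by blast
    then have "W \<subseteq> X - W'" "X - W' \<subseteq> V"
      using gts_subset[OF gts W(1)] by auto
    then show ?thesis
      using W gt_closed_Diff[OF gts] by blast
  qed
  have openG: "X - G \<in> \<mu>" and "F \<subseteq> X - G"
    using F G disj by (auto simp: gt_closed_def)
  from between[OF F this] obtain U0 where U0: "F \<subseteq> U0" "R U0 (X - G)"
    using openG unfolding R_def by blast
  have "\<exists>U :: real \<Rightarrow> 'a set. U 0 = U0 \<and> U 1 = X - G \<and>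
      (\<forall>r \<in> dyadics \<inter> {0..1}. \<forall>q \<in> dyadics \<inter> {0..1}. r < q \<longrightarrow> R (U r) (U q))"
  proof (rule recursion_on_dyadic_fractions)
    show "R U0 (X - G)" by (fact U0)
    show "\<exists>W. R U W \<and> R W V" if UV: "R U V" for U V
    proof -
      from UV obtain C where C: "U \<in> \<mu>" "V \<in> \<mu>" "gt_closed X \<mu> C" "U \<subseteq> C" "C \<subseteq> V"
        unfolding R_def by blast
      from between[OF C(3,2,5)] show ?thesis
        using C unfolding R_def by blast
    qed
    show "R U W" if "R U V" "R V W" for U V W
      using that unfolding R_def by blast
  qed
  then obtain U :: "real \<Rightarrow> 'a set" where U: "U 0 = U0" "U 1 = X - G"
    and RU: "\<And>r q. r \<in> dyadics \<inter> {0..1} \<Longrightarrow> q \<in> dyadics \<inter> {0..1} \<Longrightarrow> r < q \<Longrightarrow> R (U r) (U q)"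
    by blast
  have 01: "0 \<in> dyadics \<inter> {0..1::real}" "1 \<in> dyadics \<inter> {0..1::real}"
    using real_in_dyadics[of 0] real_in_dyadics[of 1] by auto
  have open_U: "U r \<in> \<mu>" if "r \<in> dyadics \<inter> {0..1}" for r
    using RU[OF that 01(2)] that U(2) openG unfolding R_def
    by (cases "r = 1") auto
  have mono_U: "U r \<subseteq> U q" if "r \<in> dyadics \<inter> {0..1}" "q \<in> dyadics \<inter> {0..1}" "r \<le> q" for r q
    using RU[OF that(1,2)] that(3) unfolding R_def by (cases "r = q") auto
  \<comment> \<open>The whole carrier is open only thanks to the two disjoint closed sets.\<close>
  have "X - G \<union> (X - F) \<in> \<mu>"
    using gts_Un[OF gts openG, of "X - F"] F by (simp add: gt_closed_def)
  moreover have "X - G \<union> (X - F) = X"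
    using disj by blast
  ultimately have X: "X \<in> \<mu>" by simp

  \<comment> \<open>The value 1 is the default at points that lie in no \<open>U r\<close>, in particular on \<open>G\<close>.\<close>
  define f where "f x = Inf (insert 1 {r \<in> dyadics \<inter> {0..1}. x \<in> U r})" for x
  have bdd: "bdd_below (insert 1 {r \<in> dyadics \<inter> {0..1::real}. x \<in> U r})" for x
    by (rule bdd_belowI[of _ 0]) auto
  have f_ge: "c \<le> f x" if "c \<le> 1" "\<And>r. r \<in> dyadics \<inter> {0..1} \<Longrightarrow> x \<in> U r \<Longrightarrow> c \<le> r" for c x
    unfolding f_def using that by (intro cInf_greatest) auto
  have f_le: "f x \<le> r" if "r \<in> dyadics \<inter> {0..1}" "x \<in> U r" for r x
    unfolding f_def using that bdd by (intro cInf_lower) auto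
  have f_le_1: "f x \<le> 1" for x
    unfolding f_def using bdd by (intro cInf_lower) auto
  have f_notin: "r \<le> f x" if r: "r \<in> dyadics \<inter> {0..1}" and "x \<notin> U r" for r x
  proof (rule f_ge)
    fix q assume "q \<in> dyadics \<inter> {0..1}" "x \<in> U q"
    then show "r \<le> q" using mono_U[of q r] r \<open>x \<notin> U r\<close> by force
  qed (use r in simp)
  have f_0: "0 \<le> f x" for x
    by (rule f_ge) auto
  have lower: "{x \<in> X. f x < s} \<in> \<mu>" for s
  proof (cases "s > 1")
    case True
    then have "{x \<in> X. f x < s} = X" using f_le_1 by (auto intro: le_less_trans)
    then show ?thesis using X by simp
  next
    case False
    show ?thesis
    proof (rule gts_openI[OF gts])
      fix x assume "x \<in> {x \<in> X. f x < s}"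
      then have "f x < s" by simp
      then obtain r where r: "r \<in> dyadics \<inter> {0..1}" "f x < r" "r < s"
        using dyadic_between[of "f x" s] False f_0 by (metis not_le)
      then have "x \<in> U r" using f_notin by force
      moreover have "U r \<subseteq> {x \<in> X. f x < s}"
        using f_le[OF r(1)] r(3) gts_subset[OF gts open_U[OF r(1)]] by force
      ultimately show "\<exists>W\<in>\<mu>. x \<in> W \<and> W \<subseteq> {x \<in> X. f x < s}"
        using open_U[OF r(1)] by blast
    qed
  qed
  have upper: "{x \<in> X. t < f x} \<in> \<mu>" for t
  proof (cases "t < 0")
    case True
    then have "{x \<in> X. t < f x} = X" using f_0 by (auto intro: less_le_trans)
    then show ?thesis using X by simp
  next
    case False
    show ?thesis
    proof (rule gts_openI[OF gts])
      fix x assume x: "x \<in> {x \<in> X. t < f x}"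
      then obtain r where r: "r \<in> dyadics \<inter> {0..1}" "t < r" "r < f x"
        using dyadic_between[of t "f x"] False f_le_1 by (metis mem_Collect_eq not_le)
      \<comment> \<open>A second level \<open>q\<close> is needed: \<open>x \<notin> U q\<close> keeps \<open>x\<close> out of a closed set that contains \<open>U r\<close>,
         whereas \<open>x \<notin> U r\<close> alone gives no open neighbourhood.\<close>
      obtain q where q: "q \<in> dyadics \<inter> {0..1}" "r < q" "q < f x"
        using dyadic_between[of r "f x"] r f_le_1 by (metis Int_iff atLeastAtMost_iff)
      obtain C where C: "gt_closed X \<mu> C" "U r \<subseteq> C" "C \<subseteq> U q"
        using RU[OF r(1) q(1,2)] unfolding R_def by blast
      have "x \<notin> C" using C(3) f_le[OF q(1)] q(3) by force
      moreover have "X - C \<subseteq> {x \<in> X. t < f x}"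
        using C(2) f_notin[OF r(1)] r(2) by force
      ultimately show "\<exists>W\<in>\<mu>. x \<in> W \<and> W \<subseteq> {x \<in> X. t < f x}"
        using C(1) x unfolding gt_closed_def by blast
    qed
  qed
  show thesis
  proof
    show "gt_continuous X \<mu> {0..1} gamma0 f"
      using lower upper f_0 f_le_1 by (simp add: gt_continuous_gamma0_iff[OF gts])
    show "f ` F \<subseteq> {0}"
      using f_le[OF 01(1)] U0(1) U(1) f_0 by (force intro: antisym)
    show "f ` G \<subseteq> {1}"
      using f_notin[OF 01(2)] U(2) f_le_1 by (force intro: antisym)
  qed
qed

lemma gt_T1_closed_singleton:
  assumes "gts X \<mu>" "gt_T1 X \<mu>" "x \<in> X"
  shows "gt_closed X \<mu> {x}"
proof -
  have "X - {x} \<in> \<mu>"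
  proof (rule gts_openI[OF assms(1)])
    fix y assume "y \<in> X - {x}"
    then obtain W where "W \<in> \<mu>" "y \<in> W" "x \<notin> W"
      using assms(2,3) unfolding gt_T1_def by blast
    then show "\<exists>W\<in>\<mu>. y \<in> W \<and> W \<subseteq> X - {x}"
      using gts_subset[OF assms(1)] by blast
  qed
  then show ?thesis using assms(3) by (simp add: gt_closed_def)
qed

text \<open>
  Singletons are closed by \<open>T\<^sub>1\<close>, so Urysohn's lemma applies to a point and a closed set.
\<close>

lemma gt_T4_completely_regular:
  assumes "gts X \<mu>" "gt_T4 X \<mu>"
  shows "gt_completely_regular X \<mu>"
  unfolding gt_completely_regular_def
proof (intro ballI allI impI)
  fix x F assume "x \<in> X" "gt_closed X \<mu> F \<and> x \<notin> F"
  then have "gt_closed X \<mu> {x}" "gt_closed X \<mu> F" "{x} \<inter> F = {}"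
    using gt_T1_closed_singleton assms by (auto simp: gt_T4_def)
  then obtain f where "gt_continuous X \<mu> {0..1} gamma0 f" "f ` {x} \<subseteq> {0}" "f ` F \<subseteq> {1}"
    using gt_Urysohn assms unfolding gt_T4_def by blast
  then show "\<exists>f. gt_continuous X \<mu> {0..1} gamma0 f \<and> f x = 0 \<and> f ` F \<subseteq> {1}"
    by auto
qed

section \<open>Weak structures and embeddings\<close>

lemma gt_continuous_compose:
  assumes "gt_continuous X \<mu> Y \<nu> f" "gt_continuous Y \<nu> Z \<tau> g"
  shows "gt_continuous X \<mu> Z \<tau> (g \<circ> f)"
  unfolding gt_continuous_def
proof (intro conjI ballI)
  show "g \<circ> f \<in> X \<rightarrow> Z"
    using assms by (auto simp: gt_continuous_def)
  fix N assume "N \<in> \<tau>"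
  then have "g -` N \<inter> Y \<in> \<nu>"
    using assms(2) by (simp add: gt_continuous_def)
  then have "f -` (g -` N \<inter> Y) \<inter> X \<in> \<mu>"
    using assms(1) unfolding gt_continuous_def by blast
  moreover have "f -` (g -` N \<inter> Y) \<inter> X = (g \<circ> f) -` N \<inter> X"
    using assms(1) by (auto simp: gt_continuous_def)
  ultimately show "(g \<circ> f) -` N \<inter> X \<in> \<mu>" by simp
qed

text \<open>
  A closed set of the weak structure is the preimage of a closed set of \<open>Y\<close> that misses the image
  of the given point; a separating function on \<open>Y\<close> is composed with \<open>\<phi>\<close>.
\<close>

lemma weak_structure_completely_regular:
  assumes gts: "gts Y \<nu>" and reg: "gt_completely_regular Y \<nu>" and \<phi>: "\<phi> \<in> X \<rightarrow> Y"
  shows "gt_completely_regular X (weak_structure X \<nu> \<phi>)"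
  unfolding gt_completely_regular_def
proof (intro ballI allI impI)
  let ?\<mu> = "weak_structure X \<nu> \<phi>"
  fix x F assume x: "x \<in> X" "gt_closed X ?\<mu> F \<and> x \<notin> F"
  then obtain N where N: "N \<in> \<nu>" "X - F = \<phi> -` N \<inter> X" "F \<subseteq> X"
    by (auto simp: gt_closed_def weak_structure_def)
  have cont: "gt_continuous X ?\<mu> Y \<nu> \<phi>"
    using \<phi> by (auto simp: gt_continuous_def weak_structure_def)
  have "\<phi> x \<in> Y" "\<phi> x \<notin> Y - N"
    using \<phi> x N by auto
  then obtain g where g: "gt_continuous Y \<nu> {0..1} gamma0 g" "g (\<phi> x) = 0" "g ` (Y - N) \<subseteq> {1}"
    using reg gt_closed_Diff[OF gts N(1)] unfolding gt_completely_regular_def by blast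
  have "\<phi> ` F \<subseteq> Y - N"
    using \<phi> N by auto
  then have "(g \<circ> \<phi>) ` F \<subseteq> {1}"
    using g(3) by auto
  then show "\<exists>f. gt_continuous X ?\<mu> {0..1} gamma0 f \<and> f x = 0 \<and> f ` F \<subseteq> {1}"
    using gt_continuous_compose[OF cont g(1)] g(2) by (intro exI[of _ "g \<circ> \<phi>"]) auto
qed

lemma weak_structure_T1:
  assumes "gt_T1 Y \<nu>" "\<phi> \<in> X \<rightarrow> Y" "inj_on \<phi> X"
  shows "gt_T1 X (weak_structure X \<nu> \<phi>)"
  unfolding gt_T1_def
proof (intro ballI impI)
  fix x y assume xy: "x \<in> X" "y \<in> X" "x \<noteq> y"
  then have "\<phi> x \<in> Y" "\<phi> y \<in> Y" "\<phi> x \<noteq> \<phi> y"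
    using assms(2,3) by (auto dest: inj_onD)
  then obtain N where "N \<in> \<nu>" "\<phi> x \<in> N" "\<phi> y \<notin> N"
    using assms(1) unfolding gt_T1_def by blast
  then show "\<exists>U\<in>weak_structure X \<nu> \<phi>. x \<in> U \<and> y \<notin> U"
    using xy by (auto simp: weak_structure_def)
qed

text \<open>
  This reduces statements about embeddings to statements about weak structures: continuity of \<open>\<phi>\<close>
  and of its inverse are the two inclusions between \<open>\<mu>\<close> and the weak structure.
\<close>

lemma gt_homeomorphism_onto_subspace_iff:
  assumes "\<mu> \<subseteq> Pow X"
  shows "gt_homeomorphism X \<mu> S (gt_subspace \<nu> S) \<phi> \<longleftrightarrow>
    inj_on \<phi> X \<and> \<phi> ` X = S \<and> \<mu> = weak_structure X \<nu> \<phi>"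
proof (cases "bij_betw \<phi> X S")
  case True
  then have inj: "inj_on \<phi> X" and img: "\<phi> ` X = S"
    by (auto simp: bij_betw_def)
  have inv: "inv_into X \<phi> \<in> S \<rightarrow> X"
    using img by (auto simp: inv_into_into)
  have pre: "inv_into X \<phi> -` M \<inter> S = N \<inter> S \<longleftrightarrow> M = \<phi> -` N \<inter> X" if "M \<subseteq> X" for M N
  proof -
    have "inv_into X \<phi> -` M \<inter> S = \<phi> ` M"
      using that inj img by (auto simp: image_iff)
    moreover have "\<phi> ` (\<phi> -` N \<inter> X) = N \<inter> S"
      using img by auto
    then have "\<phi> ` M = N \<inter> S \<longleftrightarrow> M = \<phi> -` N \<inter> X"
      using inj_on_image_eq_iff[OF inj that, of "\<phi> -` N \<inter> X"] by simp
    ultimately show ?thesis by simp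
  qed
  have "gt_continuous X \<mu> S (gt_subspace \<nu> S) \<phi> \<longleftrightarrow> weak_structure X \<nu> \<phi> \<subseteq> \<mu>"
  proof -
    have "\<phi> -` (N \<inter> S) \<inter> X = \<phi> -` N \<inter> X" for N
      using img by blast
    then have "(\<forall>V\<in>gt_subspace \<nu> S. \<phi> -` V \<inter> X \<in> \<mu>) \<longleftrightarrow> (\<forall>N\<in>\<nu>. \<phi> -` N \<inter> X \<in> \<mu>)"
      by (simp add: gt_subspace_def Ball_def del: vimage_Int) metis
    then show ?thesis
      using img by (auto simp: gt_continuous_def weak_structure_def)
  qed
  moreover have "gt_continuous S (gt_subspace \<nu> S) X \<mu> (inv_into X \<phi>) \<longleftrightarrow> \<mu> \<subseteq> weak_structure X \<nu> \<phi>"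
  proof -
    have "inv_into X \<phi> -` M \<inter> S \<in> gt_subspace \<nu> S \<longleftrightarrow> M \<in> weak_structure X \<nu> \<phi>" if "M \<in> \<mu>" for M
    proof -
      have "M \<subseteq> X" using that assms by blast
      then show ?thesis
        by (simp only: gt_subspace_def weak_structure_def mem_Collect_eq pre)
    qed
    then show ?thesis
      using inv by (auto simp: gt_continuous_def)
  qed
  ultimately show ?thesis
    using True inj img by (auto simp: gt_homeomorphism_def)
qed (auto simp: gt_homeomorphism_def bij_betw_def)

section \<open>Closed subspaces\<close>

lemma gts_subspace:
  assumes "gts Y \<nu>"
  shows "gts S (gt_subspace \<nu> S)"
proof -
  have "gt_subspace \<nu> S = unions (gt_subspace \<nu> S)"
  proof
    show "unions (gt_subspace \<nu> S) \<subseteq> gt_subspace \<nu> S"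
    proof
      fix V assume "V \<in> unions (gt_subspace \<nu> S)"
      then obtain \<S> where \<S>: "\<S> \<subseteq> gt_subspace \<nu> S" "V = \<Union>\<S>"
        by (auto simp: unions_def)
      have "V = \<Union>{M \<in> \<nu>. M \<inter> S \<in> \<S>} \<inter> S"
        using \<S> by (fastforce simp: gt_subspace_def)
      moreover have "\<Union>{M \<in> \<nu>. M \<inter> S \<in> \<S>} \<in> \<nu>"
        by (rule gts_Union[OF assms]) blast
      ultimately show "V \<in> gt_subspace \<nu> S"
        unfolding gt_subspace_def by blast
    qed
  qed (auto intro: unions_base)
  moreover have "gt_subspace \<nu> S \<subseteq> Pow S"
    by (auto simp: gt_subspace_def)
  ultimately show ?thesis
    using gts_unions by metis
qed

lemma gt_subspace_T1:
  assumes "gt_T1 Y \<nu>" "S \<subseteq> Y"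
  shows "gt_T1 S (gt_subspace \<nu> S)"
  unfolding gt_T1_def
proof (intro ballI impI)
  fix x y assume xy: "x \<in> S" "y \<in> S" "x \<noteq> y"
  then obtain M where "M \<in> \<nu>" "x \<in> M" "y \<notin> M"
    using assms unfolding gt_T1_def by blast
  then show "\<exists>U\<in>gt_subspace \<nu> S. x \<in> U \<and> y \<notin> U"
    using xy by (auto simp: gt_subspace_def)
qed

text \<open>
  The complement of a set that is closed in \<open>Z\<close> is the union, not an intersection, of two open
  sets of \<open>Y\<close>. Normality and compactness therefore pass to closed subspaces as usual.
\<close>

lemma gt_closed_subspaceD:
  assumes gts: "gts Y \<nu>" and Z: "gt_closed Y \<nu> Z" and F: "gt_closed Z (gt_subspace \<nu> Z) F"
  shows "gt_closed Y \<nu> F"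
proof -
  from F obtain M where M: "M \<in> \<nu>" "Z - F = M \<inter> Z" "F \<subseteq> Z"
    by (auto simp: gt_closed_def gt_subspace_def)
  have "Y - F = (Y - Z) \<union> M"
    using M Z gts_subset[OF gts M(1)] unfolding gt_closed_def by blast
  moreover have "\<dots> \<in> \<nu>"
    using gts_Un[OF gts _ M(1)] Z by (simp add: gt_closed_def)
  ultimately show ?thesis
    using M Z by (auto simp: gt_closed_def)
qed

lemma gt_closed_subspace_compact_T4:
  assumes gts: "gts Y \<nu>" and Z: "gt_closed Y \<nu> Z" and T4: "gt_compact_T4 Y \<nu>"
  shows "gt_compact_T4 Z (gt_subspace \<nu> Z)"
proof -
  have ZY: "Z \<subseteq> Y" "Y - Z \<in> \<nu>"
    using Z by (auto simp: gt_closed_def)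
  have "gt_normal Z (gt_subspace \<nu> Z)"
    unfolding gt_normal_def
  proof (intro allI impI)
    fix F G
    assume FG: "gt_closed Z (gt_subspace \<nu> Z) F \<and> gt_closed Z (gt_subspace \<nu> Z) G \<and> F \<inter> G = {}"
    then have "gt_closed Y \<nu> F" "gt_closed Y \<nu> G" "F \<inter> G = {}"
      using gt_closed_subspaceD[OF gts Z] by auto
    then obtain U V where "U \<in> \<nu>" "V \<in> \<nu>" "F \<subseteq> U" "G \<subseteq> V" "U \<inter> V = {}"
      using gt_normalD[of Y \<nu> F G] T4 unfolding gt_compact_T4_def gt_T4_def by blast
    then show "\<exists>U\<in>gt_subspace \<nu> Z. \<exists>V\<in>gt_subspace \<nu> Z. F \<subseteq> U \<and> G \<subseteq> V \<and> U \<inter> V = {}"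
      using FG by (intro bexI[of _ "U \<inter> Z"] bexI[of _ "V \<inter> Z"])
        (auto simp: gt_subspace_def gt_closed_def)
  qed
  moreover have "gt_compact Z (gt_subspace \<nu> Z)"
    unfolding gt_compact_def
  proof (intro allI impI)
    fix \<U> assume \<U>: "\<U> \<subseteq> gt_subspace \<nu> Z \<and> \<Union>\<U> = Z"
    \<comment> \<open>Lift the cover to \<open>Y\<close>, adding the complement of \<open>Z\<close>, which leaves no trace on \<open>Z\<close>.\<close>
    define \<M> where "\<M> = insert (Y - Z) {M \<in> \<nu>. M \<inter> Z \<in> \<U>}"
    have "Z \<subseteq> \<Union>\<M>"
    proof
      fix z assume "z \<in> Z"
      with \<U> obtain V where V: "V \<in> \<U>" "z \<in> V" by blast
      with \<U> obtain M where "M \<in> \<nu>" "V = M \<inter> Z"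
        by (auto simp: gt_subspace_def)
      with V show "z \<in> \<Union>\<M>" by (auto simp: \<M>_def)
    qed
    moreover have "\<M> \<subseteq> \<nu>" using ZY by (auto simp: \<M>_def)
    ultimately have \<M>: "\<M> \<subseteq> \<nu>" "\<Union>\<M> = Y"
      using ZY gts_subset[OF gts] by (auto simp: \<M>_def)
    have "\<forall>\<U>. \<U> \<subseteq> \<nu> \<and> \<Union>\<U> = Y \<longrightarrow> (\<exists>\<V>\<subseteq>\<U>. finite \<V> \<and> \<Union>\<V> = Y)"
      using T4 by (simp add: gt_compact_T4_def gt_compact_def)
    then obtain \<V> where \<V>: "\<V> \<subseteq> \<M>" "finite \<V>" "\<Union>\<V> = Y"
      using \<M> by metis
    let ?W = "(\<lambda>M. M \<inter> Z) ` (\<V> - {Y - Z})"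
    have "?W \<subseteq> \<U>" "finite ?W" "\<Union>?W = Z"
      using \<V> ZY by (auto simp: \<M>_def)
    then show "\<exists>\<V>\<subseteq>\<U>. finite \<V> \<and> \<Union>\<V> = Z" by blast
  qed
  ultimately show ?thesis
    using T4 gt_subspace_T1[OF _ ZY(1)] by (auto simp: gt_compact_T4_def gt_T4_def)
qed

lemma gt_dense_in_closure:
  assumes gts: "gts Y \<nu>" and A: "A \<subseteq> Y"
  defines "Z \<equiv> gt_closure Y \<nu> A"
  shows "gt_dense Z (gt_subspace \<nu> Z) A"
proof -
  have Z: "gt_closed Y \<nu> Z" "A \<subseteq> Z"
    unfolding Z_def by (rule gt_closed_closure[OF gts A], rule subset_gt_closure)
  have "gt_closure Z (gt_subspace \<nu> Z) A = Z"
  proof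
    have "gt_closed Z (gt_subspace \<nu> Z) Z"
      using gts_empty[OF gts_subspace[OF gts]] by (simp add: gt_closed_def)
    then show "gt_closure Z (gt_subspace \<nu> Z) A \<subseteq> Z"
      unfolding gt_closure_def by (intro Inter_lower) (use Z(2) in simp)
    show "Z \<subseteq> gt_closure Z (gt_subspace \<nu> Z) A"
      unfolding gt_closure_def[of Z]
    proof (rule Inter_greatest)
      fix F assume "F \<in> {F. gt_closed Z (gt_subspace \<nu> Z) F \<and> A \<subseteq> F}"
      then have "gt_closed Y \<nu> F" "A \<subseteq> F"
        using gt_closed_subspaceD[OF gts Z(1)] by auto
      then show "Z \<subseteq> F"
        unfolding Z_def gt_closure_def by (intro Inter_lower) simp
    qed
  qed
  then show ?thesis using Z(2) by (simp add: gt_dense_def)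
qed

section \<open>Cubes\<close>

definition cube :: "'i set \<Rightarrow> ('i \<Rightarrow> real) set" where
  "cube I = I \<rightarrow>\<^sub>E {0..1}"

definition cube_below :: "'i set \<Rightarrow> 'i \<Rightarrow> real \<Rightarrow> ('i \<Rightarrow> real) set" where
  "cube_below I i s = {p \<in> cube I. p i < s}"

definition cube_above :: "'i set \<Rightarrow> 'i \<Rightarrow> real \<Rightarrow> ('i \<Rightarrow> real) set" where
  "cube_above I i t = {p \<in> cube I. t < p i}"

text \<open>
  The subbase of the product of copies of \<open>gamma0\<close>. With unions only, the proper nonempty closed
  sets of the cube are boxes, that is products of closed intervals.
\<close>

definition cube_rays :: "'i set \<Rightarrow> ('i \<Rightarrow> real) set set" where
  "cube_rays I = (\<Union>i\<in>I. range (cube_below I i) \<union> range (cube_above I i))"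

lemma gts_cube: "gts (cube I) (unions (cube_rays I))"
  by (rule gts_unions) (auto simp: cube_rays_def cube_below_def cube_above_def)

lemma cube_below_open: "i \<in> I \<Longrightarrow> cube_below I i s \<in> unions (cube_rays I)"
  and cube_above_open: "i \<in> I \<Longrightarrow> cube_above I i t \<in> unions (cube_rays I)"
   by (rule unions_base; force simp: cube_rays_def)+

lemma cube_coordinate: "p \<in> cube I \<Longrightarrow> i \<in> I \<Longrightarrow> 0 \<le> p i \<and> p i \<le> 1"
  unfolding cube_def by (drule PiE_mem) auto

text \<open>
  Helly's theorem for intervals, coordinate by coordinate. The complement of a ray bounds one
  coordinate from below or from above. If no ray of the family is the whole cube and no two rays
  in the same coordinate cover it, then in every coordinate each lower bound lies below each
  upper bound, so the supremum of the lower bounds satisfies all of them and yields a point that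
  the family does not cover. Compactness and normality of the cube both rest on this lemma.
\<close>

lemma cube_ray_cover:
  assumes \<S>: "\<S> \<subseteq> cube_rays I" and cover: "\<Union>\<S> = cube I"
  obtains (whole) "cube I \<in> \<S>"
    | (opposite) i s t where "i \<in> I" "t < s" "cube_below I i s \<in> \<S>" "cube_above I i t \<in> \<S>"
proof (rule ccontr)
  assume neg: "\<not> thesis"
  have not_whole: "cube I \<notin> \<S>"
  proof
    assume "cube I \<in> \<S>"
    then have thesis by (rule whole)
    with neg show False ..
  qed
  have sep: "s \<le> t" if "i \<in> I" "cube_below I i s \<in> \<S>" "cube_above I i t \<in> \<S>" for i s t
  proof (rule ccontr)
    assume "\<not> s \<le> t"
    then have "t < s" by simp
    then have thesis by (rule opposite[OF that(1) _ that(2,3)])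
    with neg show False ..
  qed
  have s1: "s \<le> 1" if i: "i \<in> I" and ray: "cube_below I i s \<in> \<S>" for i s
  proof (rule ccontr)
    assume "\<not> s \<le> 1"
    then have "p i < s" if "p \<in> cube I" for p
      using cube_coordinate[OF that i] by linarith
    then have "cube_below I i s = cube I"
      by (auto simp: cube_below_def)
    then show False using not_whole ray by simp
  qed
  have t0: "0 \<le> t" if i: "i \<in> I" and ray: "cube_above I i t \<in> \<S>" for i t
  proof (rule ccontr)
    assume "\<not> 0 \<le> t"
    then have "t < p i" if "p \<in> cube I" for p
      using cube_coordinate[OF that i] by linarith
    then have "cube_above I i t = cube I"
      by (auto simp: cube_above_def)
    then show False using not_whole ray by simp
  qed
  \<comment> \<open>The lower bounds on coordinate \<open>i\<close>, with 0 added so that the supremum exists and is nonnegative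
     even if no ray bounds this coordinate.\<close>
  define L where "L i = insert 0 {s. cube_below I i s \<in> \<S>}" for i
  define p where "p = (\<lambda>i\<in>I. Sup (L i))"
  have L_le: "bdd_above (L i)" if "i \<in> I" for i
    using s1[OF that] by (intro bdd_aboveI[of _ 1]) (auto simp: L_def)
  have lo: "s \<le> p i" if "i \<in> I" "s \<in> L i" for i s
    using that L_le by (auto simp: p_def intro: cSup_upper)
  have hi: "p i \<le> c" if "i \<in> I" "\<And>s. s \<in> L i \<Longrightarrow> s \<le> c" for i c
    using that by (auto simp: p_def L_def intro!: cSup_least)
  have "p \<in> cube I"
    unfolding cube_def
  proof (rule PiE_I)
    fix i assume "i \<in> I"
    moreover from this have "s \<le> 1" if "s \<in> L i" for s
      using that s1 by (auto simp: L_def)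
    moreover have "0 \<in> L i" by (simp add: L_def)
    ultimately show "p i \<in> {0..1}"
      using lo[of i 0] hi[of i 1] by simp
  qed (simp add: p_def)
  then obtain A where A: "A \<in> \<S>" "p \<in> A"
    using cover by blast
  with \<S> obtain i where i: "i \<in> I" "A \<in> range (cube_below I i) \<union> range (cube_above I i)"
    unfolding cube_rays_def by blast
  then consider s where "A = cube_below I i s" | t where "A = cube_above I i t"
    by blast
  then show False
  proof cases
    case (1 s)
    then have "s \<le> p i" "p i < s"
      using lo[of i s] i(1) A by (auto simp: L_def cube_below_def)
    then show False by simp
  next
    case (2 t)
    have "p i \<le> t"
      using sep t0 i(1) A(1) 2 by (intro hi) (auto simp: L_def)
    moreover have "t < p i"
      using A(2) 2 by (simp add: cube_above_def)
    ultimately show False by simp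
  qed
qed

lemma cube_below_Un_above: "t < s \<Longrightarrow> cube_below I i s \<union> cube_above I i t = cube I"
  by (auto simp: cube_below_def cube_above_def)

lemma cube_T1: "gt_T1 (cube I) (unions (cube_rays I))"
  unfolding gt_T1_def
proof (intro ballI impI)
  fix p q assume pq: "p \<in> cube I" "q \<in> cube I" "p \<noteq> q"
  then obtain i where i: "i \<in> I" "p i \<noteq> q i"
    unfolding cube_def by (meson PiE_ext)
  show "\<exists>U\<in>unions (cube_rays I). p \<in> U \<and> q \<notin> U"
  proof (cases "p i < q i")
    case True
    then have "p \<in> cube_below I i (q i)" "q \<notin> cube_below I i (q i)"
      using pq by (auto simp: cube_below_def)
    then show ?thesis using cube_below_open[OF i(1)] by blast
  next
    case False
    then have "p \<in> cube_above I i (q i)" "q \<notin> cube_above I i (q i)"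
      using pq i by (auto simp: cube_above_def)
    then show ?thesis using cube_above_open[OF i(1)] by blast
  qed
qed

text \<open>
  Refine the cover to one by rays: two members, and hence two members of the cover, already
  suffice.
\<close>

lemma cube_compact: "gt_compact (cube I) (unions (cube_rays I))"
  unfolding gt_compact_def
proof (intro allI impI)
  fix \<U> assume \<U>: "\<U> \<subseteq> unions (cube_rays I) \<and> \<Union>\<U> = cube I"
  define \<S> where "\<S> = {A \<in> cube_rays I. \<exists>M\<in>\<U>. A \<subseteq> M}"
  have sub: "\<S> \<subseteq> cube_rays I" by (auto simp: \<S>_def)
  have "\<Union>\<U> \<subseteq> \<Union>\<S>"
  proof
    fix p assume "p \<in> \<Union>\<U>"
    then obtain M where M: "M \<in> \<U>" "p \<in> M" by blast
    with \<U> obtain \<T> where "\<T> \<subseteq> cube_rays I" "M = \<Union>\<T>"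
      by (auto simp: unions_def)
    with M show "p \<in> \<Union>\<S>" by (auto simp: \<S>_def)
  qed
  moreover have "\<Union>\<S> \<subseteq> \<Union>\<U>" by (auto simp: \<S>_def)
  ultimately have "\<Union>\<S> = cube I" using \<U> by blast
  from sub this have "\<exists>A\<in>\<S>. \<exists>B\<in>\<S>. cube I \<subseteq> A \<union> B"
  proof (cases rule: cube_ray_cover)
    case (opposite i s t)
    then show ?thesis using cube_below_Un_above[of t s I i] by blast
  qed blast
  then obtain M N where "M \<in> \<U>" "N \<in> \<U>" "cube I \<subseteq> M \<union> N"
    unfolding \<S>_def by blast
  then show "\<exists>\<V>\<subseteq>\<U>. finite \<V> \<and> \<Union>\<V> = cube I"
    using \<U> by (intro exI[of _ "{M, N}"]) auto
qed

text \<open>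
  The rays in the complements of two disjoint closed sets cover the cube. If one of these
  complements contains the whole cube or both rays of a covering pair, then one closed set is empty.
  Otherwise each complement contains one ray of such a pair, so the two closed sets are separated by a gap between values of a single coordinate; cutting in the middle of
  the gap gives disjoint rays around them.
\<close>

lemma cube_normal: "gt_normal (cube I) (unions (cube_rays I))"
  unfolding gt_normal_def
proof (intro allI impI)
  let ?\<nu> = "unions (cube_rays I)"
  let ?sep = "\<lambda>F G. \<exists>U\<in>?\<nu>. \<exists>V\<in>?\<nu>. F \<subseteq> U \<and> G \<subseteq> V \<and> U \<inter> V = {}"
  fix F G assume FG: "gt_closed (cube I) ?\<nu> F \<and> gt_closed (cube I) ?\<nu> G \<and> F \<inter> G = {}"
  then have "cube I - F \<in> ?\<nu>" "cube I - G \<in> ?\<nu>"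
    by (simp_all add: gt_closed_def)
  then obtain \<S> \<T> where \<S>: "\<S> \<subseteq> cube_rays I" "cube I - F = \<Union>\<S>"
      and \<T>: "\<T> \<subseteq> cube_rays I" "cube I - G = \<Union>\<T>"
    unfolding unions_def mem_Collect_eq by (elim exE conjE)
  have FGC: "F \<subseteq> cube I" "G \<subseteq> cube I"
    using FG by (auto simp: gt_closed_def)
  have cover: "\<Union>(\<S> \<union> \<T>) = cube I"
  proof -
    have "\<Union>(\<S> \<union> \<T>) = (cube I - F) \<union> (cube I - G)"
      using \<S>(2) \<T>(2) by simp
    then show ?thesis using FG by blast
  qed
  have trivial: "?sep F G" if "F = {} \<or> G = {}"
  proof -
    have "\<Union>(\<S> \<union> \<T>) \<in> ?\<nu>"
      by (rule gts_Union[OF gts_cube]) (use \<S>(1) \<T>(1) unions_base in blast)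
    then have "cube I \<in> ?\<nu>"
      by (simp only: cover)
    moreover have "{} \<in> ?\<nu>"
      by (rule gts_empty[OF gts_cube])
    ultimately show ?thesis
      using that FGC by blast
  qed
  have opp: "?sep P Q" if "i \<in> I" "t < s" "P \<subseteq> cube I - cube_below I i s" "Q \<subseteq> cube I - cube_above I i t"
    for P Q i s t
  proof (intro bexI conjI)
    let ?m = "(s + t) / 2"
    show "P \<subseteq> cube_above I i ?m" "Q \<subseteq> cube_below I i ?m"
      using that(2-4) by (force simp: cube_above_def cube_below_def)+
    show "cube_above I i ?m \<inter> cube_below I i ?m = {}"
      by (auto simp: cube_above_def cube_below_def)
  qed (use that(1) in \<open>auto intro: cube_below_open cube_above_open\<close>)
  have comm: "?sep P Q \<Longrightarrow> ?sep Q P" for P Q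
    by (metis Int_commute)
  have F: "F \<subseteq> cube I - A" if "A \<in> \<S>" for A
    using that \<S>(2) FGC by blast
  have G: "G \<subseteq> cube I - A" if "A \<in> \<T>" for A
    using that \<T>(2) FGC by blast
  have "\<S> \<union> \<T> \<subseteq> cube_rays I"
    using \<S>(1) \<T>(1) by blast
  then show "?sep F G"
    using cover
  proof (cases rule: cube_ray_cover)
    case whole
    then have "F = {} \<or> G = {}" using F G by blast
    then show ?thesis by (rule trivial)
  next
    case (opposite i s t)
    have un: "cube_below I i s \<union> cube_above I i t = cube I"
      using cube_below_Un_above[OF opposite(2)] .
    consider "cube_below I i s \<in> \<S>" "cube_above I i t \<in> \<S>" | "cube_below I i s \<in> \<T>" "cube_above I i t \<in> \<T>"
      | "cube_below I i s \<in> \<S>" "cube_above I i t \<in> \<T>" | "cube_below I i s \<in> \<T>" "cube_above I i t \<in> \<S>"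
      using opposite by blast
    then show ?thesis
    proof cases
      case 1
      then have "F = {}" using F un by blast
      then show ?thesis using trivial by blast
    next
      case 2
      then have "G = {}" using G un by blast
      then show ?thesis using trivial by blast
    next
      case 3
      show ?thesis by (rule opp[OF opposite(1,2) F[OF 3(1)] G[OF 3(2)]])
    next
      case 4
      have "?sep G F" by (rule opp[OF opposite(1,2) G[OF 4(1)] F[OF 4(2)]])
      then show ?thesis by (rule comm)
    qed
  qed
qed

lemma cube_compact_T4: "gt_compact_T4 (cube I) (unions (cube_rays I))"
  by (simp add: gt_compact_T4_def gt_T4_def cube_compact cube_normal cube_T1)

section \<open>The evaluation map\<close>

text \<open>
  All functions on the ambient type that are continuous on \<open>X\<close> serve as indices; functions that
  agree on \<open>X\<close> merely repeat a coordinate.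
\<close>

definition evaluation :: "'a set \<Rightarrow> 'a set set \<Rightarrow> 'a \<Rightarrow> 'a cube" where
  "evaluation X \<mu> x = (\<lambda>f\<in>{f. gt_continuous X \<mu> {0..1} gamma0 f}. f x)"

text \<open>
  Complete regularity says that every open set \<open>M\<close> is a union of preimages of \<open>[0,1)\<close>: around each
  of its points it contains \<open>{x. f x < 1}\<close> for some continuous \<open>f\<close> that is 1 outside \<open>M\<close>. In terms of
  the evaluation map, this is the preimage of a ray of the cube.
\<close>

lemma evaluation_weak_structure:
  fixes X :: "'a set"
  assumes gts: "gts X \<mu>" and reg: "gt_completely_regular X \<mu>"
  defines "I \<equiv> {f. gt_continuous X \<mu> {0..1} gamma0 f}"
  shows "\<mu> = weak_structure X (unions (cube_rays I)) (evaluation X \<mu>)"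
    and "evaluation X \<mu> \<in> X \<rightarrow> cube I"
proof -
  let ?e = "evaluation X \<mu>"
  have e: "?e x f = f x" if "f \<in> I" for x f
    using that by (simp add: evaluation_def I_def)
  show into: "?e \<in> X \<rightarrow> cube I"
  proof (rule Pi_I)
    fix x assume "x \<in> X"
    then have "\<forall>f\<in>I. f x \<in> {0..1}"
      unfolding I_def gt_continuous_def by blast
    then show "?e x \<in> cube I"
      unfolding evaluation_def cube_def I_def[symmetric] restrict_PiE_iff .
  qed
  have "gt_continuous X \<mu> (cube I) (unions (cube_rays I)) ?e"
    unfolding gt_continuous_unions_iff[OF gts]
  proof (intro conjI ballI)
    fix B assume "B \<in> cube_rays I"
    then obtain f where f: "f \<in> I" "B \<in> range (cube_below I f) \<union> range (cube_above I f)"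
      by (auto simp: cube_rays_def)
    have "?e -` cube_below I f s \<inter> X = {x \<in> X. f x < s}"
      "?e -` cube_above I f s \<inter> X = {x \<in> X. s < f x}" for s
      using e[OF f(1)] into by (auto simp: cube_below_def cube_above_def)
    then show "?e -` B \<inter> X \<in> \<mu>"
      using f gt_continuous_gamma0_iff[OF gts, of f] by (auto simp: I_def)
  qed (rule into)
  then have "weak_structure X (unions (cube_rays I)) ?e \<subseteq> \<mu>"
    by (auto simp: gt_continuous_def weak_structure_def)
  moreover have "M \<in> weak_structure X (unions (cube_rays I)) ?e" if M: "M \<in> \<mu>" for M
  proof -
    let ?J = "{f \<in> I. f ` (X - M) \<subseteq> {1}}"
    let ?N = "\<Union>f\<in>?J. cube_below I f 1"
    have "?e -` ?N \<inter> X = M"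
    proof
      show "?e -` ?N \<inter> X \<subseteq> M"
        by (auto simp: cube_below_def e)
      show "M \<subseteq> ?e -` ?N \<inter> X"
      proof
        fix x assume x: "x \<in> M"
        then have "x \<in> X" "x \<notin> X - M" using gts_subset[OF gts M] by auto
        then obtain f where f: "f \<in> I" "f x = 0" "f ` (X - M) \<subseteq> {1}"
          using reg gt_closed_Diff[OF gts M] unfolding gt_completely_regular_def I_def by blast
        then have "?e x \<in> cube_below I f 1"
          using into \<open>x \<in> X\<close> by (auto simp: cube_below_def e)
        then show "x \<in> ?e -` ?N \<inter> X"
          using f \<open>x \<in> X\<close> by blast
      qed
    qed
    moreover have "?N \<in> unions (cube_rays I)"
      by (rule gts_Union[OF gts_cube]) (auto intro: cube_below_open)
    ultimately show ?thesis
      unfolding weak_structure_def by blast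
  qed
  ultimately show "\<mu> = weak_structure X (unions (cube_rays I)) ?e" by blast
qed

text \<open>
  A weak structure cannot distinguish points with the same image.
\<close>

lemma weak_structure_injective_if_T1:
  assumes "\<mu> = weak_structure X \<nu> \<phi>" "gt_T1 X \<mu>"
  shows "inj_on \<phi> X"
proof (rule inj_onI, rule ccontr)
  fix x y assume "x \<in> X" "y \<in> X" "\<phi> x = \<phi> y" "x \<noteq> y"
  moreover from this obtain U where "U \<in> \<mu>" "x \<in> U" "y \<notin> U"
    using assms(2) unfolding gt_T1_def by blast
  ultimately show False
    using assms(1) by (auto simp: weak_structure_def)
qed

text \<open>
  The target is the closure of the image of the evaluation map, which makes the map dense and, as a
  closed subspace of the cube, is still compact and \<open>T\<^sub>4\<close>.
\<close>

lemma completely_regular_compactification: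
  fixes X :: "'a set"
  assumes gts: "gts X \<mu>" and reg: "gt_completely_regular X \<mu>"
  obtains Y :: "'a cube set" and \<nu> \<phi> where
    "gts Y \<nu>" "gt_compact_T4 Y \<nu>" "\<phi> \<in> X \<rightarrow> Y" "gt_dense Y \<nu> (\<phi> ` X)" "\<mu> = weak_structure X \<nu> \<phi>"
proof -
  define I where "I = {f. gt_continuous X \<mu> {0..1} gamma0 f}"
  let ?C = "cube I" let ?\<nu> = "unions (cube_rays I)" let ?e = "evaluation X \<mu>"
  define Y where "Y = gt_closure ?C ?\<nu> (?e ` X)"
  note ev = evaluation_weak_structure[OF gts reg, folded I_def]
  have sub: "?e ` X \<subseteq> ?C" using ev(2) by blast
  have into: "?e \<in> X \<rightarrow> Y"
    using subset_gt_closure[of "?e ` X" ?C ?\<nu>] by (auto simp: Y_def)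
  have pre: "?e -` (N \<inter> Y) \<inter> X = ?e -` N \<inter> X" for N
    using into by auto
  have "weak_structure X (gt_subspace ?\<nu> Y) ?e = {?e -` (N \<inter> Y) \<inter> X |N. N \<in> ?\<nu>}"
    unfolding weak_structure_def gt_subspace_def by blast
  then have "weak_structure X (gt_subspace ?\<nu> Y) ?e = \<mu>"
    using ev(1) unfolding weak_structure_def pre by simp
  moreover have "gt_dense Y (gt_subspace ?\<nu> Y) (?e ` X)"
    unfolding Y_def by (rule gt_dense_in_closure[OF gts_cube sub])
  moreover have "gt_compact_T4 Y (gt_subspace ?\<nu> Y)"
    using gt_closed_subspace_compact_T4[OF gts_cube _ cube_compact_T4]
      gt_closed_closure[OF gts_cube sub] by (simp add: Y_def)
  ultimately show thesis
    using that gts_subspace[OF gts_cube] into by blast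
qed

section \<open>The characterizations\<close>

lemma weak_structure_of_map_to_T4:
  assumes "weak_structure_of_map_to B gt_T4 X \<mu>"
  shows "gt_completely_regular X \<mu>"
  using assms weak_structure_completely_regular gt_T4_completely_regular
  unfolding weak_structure_of_map_to_def by blast

lemma homeomorphic_to_subspace_of_T4:
  fixes B :: "'b itself"
  assumes gts: "gts X \<mu>" and "homeomorphic_to_subspace_of B gt_T4 X \<mu>"
  shows "gt_T35 X \<mu>"
proof -
  from assms(2) obtain Y :: "'b set" and \<nu> S \<phi> where Y: "gts Y \<nu>" "gt_T4 Y \<nu>" "S \<subseteq> Y"
    and "gt_homeomorphism X \<mu> S (gt_subspace \<nu> S) \<phi>"
    unfolding homeomorphic_to_subspace_of_def gt_homeomorphic_def by blast
  then have \<phi>: "inj_on \<phi> X" "\<phi> ` X = S" "\<mu> = weak_structure X \<nu> \<phi>"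
    using gt_homeomorphism_onto_subspace_iff[of \<mu> X S \<nu> \<phi>] gts by (auto simp: gts_def)
  then have "\<phi> \<in> X \<rightarrow> Y" using Y(3) by auto
  then show ?thesis
    using weak_structure_completely_regular[of Y \<nu> \<phi> X] weak_structure_T1[of Y \<nu> \<phi> X]
      gt_T4_completely_regular[of Y \<nu>] Y \<phi> by (simp add: gt_T35_def gt_T4_def)
qed

lemma completely_regular_imp_weak_structure_of_dense_map:
  assumes "gts X \<mu>" "gt_completely_regular X \<mu>"
  shows "weak_structure_of_dense_map_to TYPE('a cube) gt_compact_T4 (X :: 'a set) \<mu>"
  using completely_regular_compactification[OF assms]
  unfolding weak_structure_of_dense_map_to_def by metis

lemma T35_imp_homeomorphic_to_dense_subspace:
  assumes "gts X \<mu>" "gt_T35 X \<mu>"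
  shows "homeomorphic_to_dense_subspace_of TYPE('a cube) gt_compact_T4 (X :: 'a set) \<mu>"
proof -
  have "gt_completely_regular X \<mu>" "gt_T1 X \<mu>"
    using assms(2) by (auto simp: gt_T35_def)
  then obtain Y :: "'a cube set" and \<nu> \<phi> where
    Y: "gts Y \<nu>" "gt_compact_T4 Y \<nu>" "\<phi> \<in> X \<rightarrow> Y" "gt_dense Y \<nu> (\<phi> ` X)" "\<mu> = weak_structure X \<nu> \<phi>"
    using completely_regular_compactification[OF assms(1)] by blast
  have "inj_on \<phi> X"
    by (rule weak_structure_injective_if_T1) fact+
  then have "gt_homeomorphism X \<mu> (\<phi> ` X) (gt_subspace \<nu> (\<phi> ` X)) \<phi>"
    using gt_homeomorphism_onto_subspace_iff[of \<mu> X "\<phi> ` X" \<nu> \<phi>] assms(1) Y(5)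
    by (simp add: gts_def)
  moreover have "\<phi> ` X \<subseteq> Y" using Y(3) by blast
  ultimately show ?thesis
    using Y unfolding homeomorphic_to_dense_subspace_of_def gt_homeomorphic_def by blast
qed

lemma homeomorphic_to_subspace_of_weaken:
  shows homeomorphic_to_subspace_compact_T4_imp_T4:
      "homeomorphic_to_subspace_of B gt_compact_T4 X \<mu> \<Longrightarrow> homeomorphic_to_subspace_of B gt_T4 X \<mu>"
    and homeomorphic_to_dense_subspace_compact_T4_imp_T4:
      "homeomorphic_to_dense_subspace_of B gt_compact_T4 X \<mu> \<Longrightarrow>
       homeomorphic_to_dense_subspace_of B gt_T4 X \<mu>"
    and homeomorphic_to_dense_subspace_imp_subspace:
      "homeomorphic_to_dense_subspace_of B P X \<mu> \<Longrightarrow> homeomorphic_to_subspace_of B P X \<mu>"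
  unfolding homeomorphic_to_subspace_of_def homeomorphic_to_dense_subspace_of_def gt_compact_T4_def
  by meson+

lemma weak_structure_of_map_to_weaken:
  shows weak_structure_of_map_to_compact_T4_imp_T4:
      "weak_structure_of_map_to B gt_compact_T4 X \<mu> \<Longrightarrow> weak_structure_of_map_to B gt_T4 X \<mu>"
    and weak_structure_of_dense_map_to_compact_T4_imp_T4:
      "weak_structure_of_dense_map_to B gt_compact_T4 X \<mu> \<Longrightarrow>
       weak_structure_of_dense_map_to B gt_T4 X \<mu>"
    and weak_structure_of_dense_map_to_imp_map_to:
      "weak_structure_of_dense_map_to B P X \<mu> \<Longrightarrow> weak_structure_of_map_to B P X \<mu>"
  unfolding weak_structure_of_map_to_def weak_structure_of_dense_map_to_def gt_compact_T4_def
  by (elim exE conjE; intro exI conjI; assumption)+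

theorem proposition4p19:
  fixes X :: "'a set" and \<mu> :: "'a set set"
  assumes "gts X \<mu>"
  shows
    "((gt_T35 X \<mu> \<longleftrightarrow> homeomorphic_to_subspace_of TYPE('a cube) gt_T4 X \<mu>) \<and>
      (gt_T35 X \<mu> \<longleftrightarrow> homeomorphic_to_dense_subspace_of TYPE('a cube) gt_T4 X \<mu>) \<and>
      (gt_T35 X \<mu> \<longleftrightarrow> homeomorphic_to_subspace_of TYPE('a cube) gt_compact_T4 X \<mu>) \<and>
      (gt_T35 X \<mu> \<longleftrightarrow> homeomorphic_to_dense_subspace_of TYPE('a cube) gt_compact_T4 X \<mu>) \<and>
      (homeomorphic_to_subspace_of TYPE('b) gt_T4 X \<mu> \<longrightarrow> gt_T35 X \<mu>) \<and>
      (homeomorphic_to_dense_subspace_of TYPE('b) gt_T4 X \<mu> \<longrightarrow> gt_T35 X \<mu>))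
   \<and> ((gt_completely_regular X \<mu> \<longleftrightarrow> weak_structure_of_map_to TYPE('a cube) gt_T4 X \<mu>) \<and>
      (gt_completely_regular X \<mu> \<longleftrightarrow> weak_structure_of_dense_map_to TYPE('a cube) gt_T4 X \<mu>) \<and>
      (gt_completely_regular X \<mu> \<longleftrightarrow> weak_structure_of_map_to TYPE('a cube) gt_compact_T4 X \<mu>) \<and>
      (gt_completely_regular X \<mu> \<longleftrightarrow> weak_structure_of_dense_map_to TYPE('a cube) gt_compact_T4 X \<mu>) \<and>
      (weak_structure_of_map_to TYPE('b) gt_T4 X \<mu> \<longrightarrow> gt_completely_regular X \<mu>) \<and>
      (weak_structure_of_dense_map_to TYPE('b) gt_T4 X \<mu> \<longrightarrow> gt_completely_regular X \<mu>))"
  by (intro conjI iffI impI;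
      meson assms homeomorphic_to_subspace_of_T4 T35_imp_homeomorphic_to_dense_subspace
        homeomorphic_to_subspace_of_weaken weak_structure_of_map_to_T4
        completely_regular_imp_weak_structure_of_dense_map weak_structure_of_map_to_weaken)

end
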